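(* Let $N\ge 1$ be an integer and let $\mathcal X$ be a finite alphabet with $|\mathcal X|\ge 2$. Let $M_3$ be the smallest integer $m$ for which there is at least one support-set $S\subseteq\mathcal X^N$ with $|S|=m$ that requires each of the $N$ informants to transmit, i.e. with $\#_n(S)=N$. Then $M_3=N+1$.
   Context: A support-set is a nonempty subset $S\subseteq \mathcal X^N$ (the support of a joint probability distribution of $N$ random variables with values in $\mathcal X$). There are $N$ informants and a sink. A data-vector $x=(x_1,\dots,x_N)\in S$ is revealed to the informants, informant $i$ seeing only $x_i$; only the sink knows $S$. The sink must learn $x$ exactly by interactively querying informants: it queries one informant at a time, a queried informant $i$ reports its value $x_i$ to the sink, and the choice of the next informant to query (or the decision to stop) may depend on $S$ and on all the values reported so far. The sink stops when $x$ is the only element of $S$ consistent with the reported values (possibly without any query if $|S|=1$). Such a querying strategy is a deterministic adaptive protocol for $S$. For a protocol, its worst-case number of queried informants is the maximum, over $x\in S$, of the number of distinct informants queried when the data-vector is $x$. Define $\#_n(S)$ as the minimum over all protocols for $S$ of the worst-case number of queried informants; thus $0\le \#_n(S)\le N$. The support-set $S$ is said to require each of the $N$ informants to transmit (to be informant-incompressible) if $\#_n(S)=N$. *)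

theory Defs
  imports Main "HOL-Library.FuncSet"
begin

definition support_set :: "nat \<Rightarrow> 'a set \<Rightarrow> (nat \<Rightarrow> 'a) set \<Rightarrow> bool" where
  "support_set N X S \<longleftrightarrow> S \<noteq> {} \<and> S \<subseteq> ({..<N} \<rightarrow>\<^sub>E X)"

text \<open>
  A querying strategy is a decision tree: the continuation after a query is a function of the
  reported value, so that every node of the tree corresponds to the sequence of informants
  queried and values reported so far.
\<close>

datatype 'a protocol = Stop | Query nat "'a \<Rightarrow> 'a protocol"

text \<open>
  In the recursive call the set \<open>S\<close> is replaced by the set of those data-vectors
  that are still consistent with the reported values. The sink stops precisely when a single
  one is left. Behaviour on values that cannot be reported is left unconstrained.
\<close>

primrec protocol_for :: "nat \<Rightarrow> (nat \<Rightarrow> 'a) set \<Rightarrow> 'a protocol \<Rightarrow> bool" where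
  "protocol_for N S Stop \<longleftrightarrow> is_singleton S"
| "protocol_for N S (Query i f) \<longleftrightarrow>
     \<not> is_singleton S \<and> i < N \<and>
     (\<forall>v \<in> (\<lambda>x. x i) ` S. protocol_for N {x \<in> S. x i = v} (f v))"

primrec queried :: "'a protocol \<Rightarrow> (nat \<Rightarrow> 'a) \<Rightarrow> nat set" where
  "queried Stop x = {}"
| "queried (Query i f) x = insert i (queried (f (x i)) x)"

definition worst_case :: "(nat \<Rightarrow> 'a) set \<Rightarrow> 'a protocol \<Rightarrow> nat" where
  "worst_case S P = Max ((\<lambda>x. card (queried P x)) ` S)"

definition num_informants :: "nat \<Rightarrow> (nat \<Rightarrow> 'a) set \<Rightarrow> nat" where
  "num_informants N S = (LEAST k. \<exists>P. protocol_for N S P \<and> worst_case S P = k)"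

definition informant_incompressible :: "nat \<Rightarrow> (nat \<Rightarrow> 'a) set \<Rightarrow> bool" where
  "informant_incompressible N S \<longleftrightarrow> num_informants N S = N"

definition M3 :: "nat \<Rightarrow> 'a set \<Rightarrow> nat" where
  "M3 N X = (LEAST m. \<exists>S. support_set N X S \<and> card S = m \<and> informant_incompressible N S)"

text \<open>The minimum in \<open>num_informants\<close> ranges over a nonempty set.\<close>

lemma protocol_for_exists:
  assumes "finite X" and "support_set N X S"
  shows "\<exists>P. protocol_for N S P"
proof -
  have "finite S"
    using assms finite_PiE[of "{..<N}" "\<lambda>_. X"]
    by (auto simp: support_set_def intro: finite_subset)
  then show ?thesis
    using assms(2)
  proof (induction S rule: finite_psubset_induct)
    case (psubset S)
    show ?case
    proof (cases "is_singleton S")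
      case True
      then have "protocol_for N S Stop" by simp
      then show ?thesis by blast
    next
      case False
      from psubset.prems obtain x where x: "x \<in> S"
        by (auto simp: support_set_def)
      with False obtain y where y: "y \<in> S" "y \<noteq> x"
        by (auto simp: is_singleton_def)
      from x y psubset.prems have "x \<in> {..<N} \<rightarrow>\<^sub>E X" "y \<in> {..<N} \<rightarrow>\<^sub>E X"
        by (auto simp: support_set_def)
      with y(2) obtain i where i: "i < N" "x i \<noteq> y i"
        by (metis PiE_ext lessThan_iff)
      have "\<exists>P. protocol_for N {z \<in> S. z i = v} P" if "v \<in> (\<lambda>x. x i) ` S" for v
      proof (rule psubset.IH)
        have "x \<notin> {z \<in> S. z i = v} \<or> y \<notin> {z \<in> S. z i = v}"
          using i(2) by auto
        with x y(1) show "{z \<in> S. z i = v} \<subset> S"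
          by blast
        show "support_set N X {z \<in> S. z i = v}"
          using that psubset.prems by (auto simp: support_set_def)
      qed
      then have "\<exists>f. \<forall>v \<in> (\<lambda>x. x i) ` S. protocol_for N {z \<in> S. z i = v} (f v)"
        by (intro bchoice ballI)
      then obtain f where "\<forall>v \<in> (\<lambda>x. x i) ` S. protocol_for N {z \<in> S. z i = v} (f v)" ..
      with False i(1) have "protocol_for N S (Query i f)" by simp
      then show ?thesis by blast
    qed
  qed
qed

end

theory Submission
  imports Defs
begin

text \<open>
  Querying a coordinate on which two consistent data-vectors differ leaves strictly fewer
  candidates, so \<open>S\<close> never needs more than \<open>card S - 1\<close> queries; hence
  incompressibility forces \<open>card S \<ge> N + 1\<close>. Conversely, take a constant vector together
  with its \<open>N\<close> modifications in a single coordinate: if the constant vector is revealed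
  and informant \<open>i\<close> is not queried, the vector modified at \<open>i\<close> remains consistent.
\<close>

lemma finite_support_set:
  assumes "finite X" and "support_set N X S"
  shows "finite S"
  using assms finite_PiE[of "{..<N}" "\<lambda>_. X"]
  by (auto simp: support_set_def intro: finite_subset)

lemma queried_subset:
  assumes "protocol_for N S P" and "x \<in> S"
  shows "queried P x \<subseteq> {..<N}"
  using assms
proof (induction P arbitrary: S)
  case Stop
  then show ?case by simp
next
  case (Query i f)
  then have "queried (f (x i)) x \<subseteq> {..<N}"
    by (intro Query.IH[of _ "{z \<in> S. z i = x i}"]) auto
  with Query.prems show ?case by simp
qed

text \<open>If \<open>y\<close> gives the same reports as \<open>x\<close> at every informant
  queried on \<open>x\<close>, the protocol takes the same branch at each node. Both vectors then
  stay among the candidates down to the leaf, where only one is left.\<close>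

lemma queried_determines:
  assumes "protocol_for N S P" and "x \<in> S" and "y \<in> S"
    and "\<And>i. i \<in> queried P x \<Longrightarrow> y i = x i"
  shows "y = x"
  using assms
proof (induction P arbitrary: S)
  case Stop
  then show ?case by (auto simp: is_singleton_def)
next
  case (Query i f)
  then show ?case
    by (intro Query.IH[of "f (x i)" "{z \<in> S. z i = x i}"]) auto
qed

text \<open>The bound is stated for each vector instead of for \<open>worst_case\<close>, so that
  the induction can follow the branch which that vector selects.\<close>

lemma protocol_card_queried_less:
  assumes "finite X" and "support_set N X S"
  shows "\<exists>P. protocol_for N S P \<and> (\<forall>x\<in>S. card (queried P x) < card S)"
  using finite_support_set[OF assms] assms(2)
proof (induction S rule: finite_psubset_induct)
  case (psubset S)
  show ?case
  proof (cases "is_singleton S")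
    case True
    then have "protocol_for N S Stop \<and> (\<forall>x\<in>S. card (queried Stop x) < card S)"
      by (auto simp: is_singleton_altdef)
    then show ?thesis by blast
  next
    case False
    from psubset.prems obtain x where x: "x \<in> S"
      by (auto simp: support_set_def)
    with False obtain y where y: "y \<in> S" "y \<noteq> x"
      by (auto simp: is_singleton_def)
    from x y psubset.prems have "x \<in> {..<N} \<rightarrow>\<^sub>E X" "y \<in> {..<N} \<rightarrow>\<^sub>E X"
      by (auto simp: support_set_def)
    with y(2) obtain i where i: "i < N" "x i \<noteq> y i"
      by (metis PiE_ext lessThan_iff)
    let ?S = "\<lambda>v. {z \<in> S. z i = v}"
    have smaller: "?S v \<subset> S" for v
    proof -
      have "x \<notin> ?S v \<or> y \<notin> ?S v"
        using i(2) by auto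
      with x y(1) show ?thesis by blast
    qed
    have "\<forall>v\<in>(\<lambda>x. x i) ` S. \<exists>P. protocol_for N (?S v) P \<and>
            (\<forall>z\<in>?S v. card (queried P z) < card (?S v))"
    proof
      fix v assume "v \<in> (\<lambda>x. x i) ` S"
      then have "support_set N X (?S v)"
        using psubset.prems by (auto simp: support_set_def)
      then show "\<exists>P. protocol_for N (?S v) P \<and>
            (\<forall>z\<in>?S v. card (queried P z) < card (?S v))"
        by (intro psubset.IH smaller)
    qed
    from bchoice[OF this] obtain f where f:
      "\<forall>v\<in>(\<lambda>x. x i) ` S. protocol_for N (?S v) (f v) \<and>
            (\<forall>z\<in>?S v. card (queried (f v) z) < card (?S v))" ..
    have "card (queried (Query i f) z) < card S" if "z \<in> S" for z
    proof -
      \<comment> \<open>Only an upper bound, since the chosen subprotocol might query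
        \<open>i\<close> again. The extra query is absorbed by the strict bound in the branch, and
        the branch itself is strictly smaller than \<open>S\<close>.\<close>
      have "card (queried (Query i f) z) \<le> Suc (card (queried (f (z i)) z))"
        by (simp add: card_insert_le_m1)
      also have "\<dots> \<le> card (?S (z i))"
        using f that by (auto simp: Suc_le_eq)
      also have "\<dots> < card S"
        using psubset_card_mono[OF psubset.hyps(1) smaller] .
      finally show ?thesis .
    qed
    moreover have "protocol_for N S (Query i f)"
      using False i(1) f by simp
    ultimately show ?thesis by blast
  qed
qed

lemma num_informants_le_worst_case:
  "protocol_for N S P \<Longrightarrow> num_informants N S \<le> worst_case S P"
  unfolding num_informants_def by (rule Least_le) blast

lemma num_informants_less_card:
  assumes "finite X" and "support_set N X S"
  shows "num_informants N S < card S"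
proof -
  obtain P where P: "protocol_for N S P" "\<forall>x\<in>S. card (queried P x) < card S"
    using protocol_card_queried_less[OF assms] by blast
  \<comment> \<open>The image under \<open>Max\<close> is finite and nonempty, so its maximum
    inherits the strict bound.\<close>
  have "worst_case S P < card S"
    using P(2) finite_support_set[OF assms] assms(2)
    by (simp add: worst_case_def support_set_def)
  with num_informants_le_worst_case[OF P(1)] show ?thesis by simp
qed

text \<open>One vector \<open>z\<close> on which every protocol queries everybody suffices: it gives
  all protocols the same worst case \<open>N\<close>, the largest possible.\<close>

lemma informant_incompressibleI:
  assumes "finite X" and "support_set N X S" and "z \<in> S"
    and all: "\<And>P. protocol_for N S P \<Longrightarrow> queried P z = {..<N}"
  shows "informant_incompressible N S"
proof -
  have worst_case: "worst_case S P = N" if P: "protocol_for N S P" for P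
    unfolding worst_case_def
  proof (rule Max_eqI)
    show "finite ((\<lambda>x. card (queried P x)) ` S)"
      using finite_support_set[OF assms(1,2)] by simp
    show "k \<le> N" if "k \<in> (\<lambda>x. card (queried P x)) ` S" for k
      using that queried_subset[OF P] card_mono[of "{..<N}"] by fastforce
    show "N \<in> (\<lambda>x. card (queried P x)) ` S"
      using all[OF P] assms(3) by (intro image_eqI[of _ _ z]) auto
  qed
  \<comment> \<open>Some protocol must exist for the value \<open>N\<close> to be attained in the
    \<open>LEAST\<close>.\<close>
  obtain P where "protocol_for N S P"
    using protocol_for_exists[OF assms(1,2)] ..
  then show ?thesis
    unfolding informant_incompressible_def num_informants_def
    by (intro Least_equality) (auto simp: worst_case)
qed

lemma informant_incompressible_star:
  fixes N :: nat
  assumes "finite X" and "a \<in> X" and "b \<in> X" and "a \<noteq> b"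
  defines "z \<equiv> \<lambda>i\<in>{..<N}. a"
  defines "S \<equiv> insert z ((\<lambda>i. z(i := b)) ` {..<N})"
  shows "support_set N X S" and "card S = N + 1" and "informant_incompressible N S"
proof -
  have ne: "z(i := b) \<noteq> z" if "i < N" for i
    using that assms(4) by (auto simp: z_def fun_eq_iff intro!: exI[of _ i])
  have inj: "inj_on (\<lambda>i. z(i := b)) {..<N}"
  proof (rule inj_onI)
    fix i j assume "i \<in> {..<N}" and "z(i := b) = z(j := b)"
    \<comment> \<open>Compare both sides at coordinate \<open>i\<close>: the left is
      \<open>b\<close>, while the right is \<open>a\<close> unless \<open>j = i\<close>.\<close>
    then show "i = j"
      using assms(4) by (auto simp: z_def dest!: fun_cong[of _ _ i] split: if_splits)
  qed
  show supp: "support_set N X S"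
    using assms(2,3) by (auto simp: support_set_def S_def z_def PiE_iff extensional_def
        split: if_splits)
  have "z \<notin> (\<lambda>i. z(i := b)) ` {..<N}"
    using ne by (metis imageE lessThan_iff)
  then show "card S = N + 1"
    using inj by (simp add: S_def card_image)
  show "informant_incompressible N S"
  proof (rule informant_incompressibleI[OF assms(1) supp])
    show "z \<in> S"
      by (simp add: S_def)
    fix P assume P: "protocol_for N S P"
    have "i \<in> queried P z" if "i < N" for i
    proof (rule ccontr)
      assume "i \<notin> queried P z"
      then have "z(i := b) = z"
        using that by (intro queried_determines[OF P]) (auto simp: S_def)
      with ne[OF that] show False by simp
    qed
    with queried_subset[OF P \<open>z \<in> S\<close>] show "queried P z = {..<N}"
      by auto
  qed
qed

theorem lemma3:
  fixes N :: nat and X :: "'a set"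
  assumes "N \<ge> 1" and "finite X" and "card X \<ge> 2"
  shows "M3 N X = N + 1"
  unfolding M3_def
proof (rule Least_equality)
  obtain a b where "a \<in> X" "b \<in> X" "a \<noteq> b"
    using assms(3) by (meson card_2_iff' obtain_subset_with_card_n subsetD)
  then show "\<exists>S. support_set N X S \<and> card S = N + 1 \<and> informant_incompressible N S"
    using informant_incompressible_star[OF assms(2)] by blast
next
  fix m assume "\<exists>S. support_set N X S \<and> card S = m \<and> informant_incompressible N S"
  \<comment> \<open>Incompressibility turns the strict bound on \<open>num_informants N S\<close>
    into \<open>N < card S\<close>.\<close>
  then show "N + 1 \<le> m"
    using num_informants_less_card[OF assms(2)]
    by (fastforce simp: informant_incompressible_def)
qed

end
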